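(* Let $(\mathcal{L},\mathcal{H},(\cdot,\cdot))$ be an extended affine Lie superalgebra with root system $R=R_0\cup R_1$. Let $i\in\{0,1\}$ and $\alpha\in R_i$ with $(\alpha,\alpha)\neq0$, and set $h_\alpha:=2t_\alpha/(\alpha,\alpha)$, where $t_\alpha$ is the unique element of $\mathcal{H}$ representing $\alpha$ through the form restricted to $\mathcal{H}$. Then there are $y_{\alpha}\in\mathcal{L}_{\bar i}^{\alpha}$ and $y_{-\alpha}\in\mathcal{L}_{\bar i}^{-\alpha}$ such that $(y_\alpha,y_{-\alpha},h_\alpha)$ is an $\mathfrak{sl}_2$-super triple for the subsuperalgebra $\mathcal{G}(\alpha)$ of $\mathcal{L}$ generated by $\{y_\alpha,y_{-\alpha},h_\alpha\}$. In particular, if $\alpha\in R_1$ and $(\alpha,\alpha)\neq0$, then $2\alpha\in R_0$.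
   Context: All vector spaces are over a field $\mathbb{F}$ of characteristic zero. A super-toral triple $(\mathcal{L},\mathcal{H},(\cdot,\cdot))$ consists of a nonzero Lie superalgebra $\mathcal{L}=\mathcal{L}_{\bar 0}\oplus\mathcal{L}_{\bar 1}$, a nontrivial (nonzero) subalgebra $\mathcal{H}$ of $\mathcal{L}_{\bar 0}$ and a nondegenerate invariant even supersymmetric bilinear form $(\cdot,\cdot)$ on $\mathcal{L}$ such that: $\mathcal{L}$ has a weight space decomposition $\mathcal{L}=\bigoplus_{\alpha\in\mathcal{H}^*}\mathcal{L}^\alpha$ with respect to $\mathcal{H}$ via the adjoint representation, where $\mathcal{L}^\alpha=\{x\in\mathcal{L}\mid [h,x]=\alpha(h)x\ \forall h\in\mathcal{H}\}$; and the restriction of the form to $\mathcal{H}$ is nondegenerate. Then $\mathcal{H}$ is abelian and, for $i\in\{0,1\}$, $\mathcal{L}_{\bar i}=\bigoplus_\alpha\mathcal{L}_{\bar i}^\alpha$ with $\mathcal{L}_{\bar i}^\alpha:=\mathcal{L}_{\bar i}\cap\mathcal{L}^\alpha$. Put $R:=\{\alpha\in\mathcal{H}^*\mid\mathcal{L}^\alpha\neq\{0\}\}$ (the root system) and $R_i:=\{\alpha\in\mathcal{H}^*\mid\mathcal{L}_{\bar i}^\alpha\neq\{0\}\}$ for $i=0,1$, so $R=R_0\cup R_1$. Let $\mathfrak{p}:\mathcal{H}\to\mathcal{H}^*$, $h\mapsto(h,\cdot)$, which is injective, and let $\mathcal{H}^{\mathfrak{p}}$ be its image. For $\alpha\in\mathcal{H}^{\mathfrak{p}}$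 let $t_\alpha\in\mathcal{H}$ be the unique element with $\alpha=(t_\alpha,\cdot)$ on $\mathcal{H}$, and set $(\alpha,\beta):=(t_\alpha,t_\beta)$ for $\alpha,\beta\in\mathcal{H}^{\mathfrak{p}}$. A super-toral triple is an extended affine Lie superalgebra if (1) for $i\in\{0,1\}$ and $\alpha\in R_i\setminus\{0\}$ there are $x_\alpha\in\mathcal{L}_{\bar i}^\alpha$ and $x_{-\alpha}\in\mathcal{L}_{\bar i}^{-\alpha}$ with $0\neq[x_\alpha,x_{-\alpha}]\in\mathcal{H}$ (this implies $R\subseteq\mathcal{H}^{\mathfrak{p}}$, so that $(\alpha,\beta)$ is defined for roots), and (2) for $\alpha\in R$ with $(\alpha,\alpha)\neq0$ and $x\in\mathcal{L}^\alpha$, the map $\mathrm{ad}_x:\mathcal{L}\to\mathcal{L}$, $y\mapsto[x,y]$, is locally nilpotent. A triple $(x,y,h)$ of nonzero elements of a Lie superalgebra $\mathfrak{g}$ is an $\mathfrak{sl}_2$-super triple for $\mathfrak{g}$ if $\{x,y,h\}$ generates $\mathfrak{g}$ as a Lie superalgebra, $x,y$ are homogeneous of the same degree, and $[h,x]=2x$, $[h,y]=-2y$, $[x,y]=h$. *)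

theory Defs
  imports Complex_Main "HOL-Library.Z2"
begin

text \<open>
  Vector spaces are subspaces of an ambient vector space given by a scalar multiplication
  \<open>scale\<close> on a type \<open>'a\<close> (locale \<^locale>\<open>vector_space\<close>), so that a Lie superalgebra and its
  subsuperalgebras are objects of the same kind. Parities are elements of the two-element field
  \<open>bit\<close>. Brackets and forms are functions on the whole type that are constrained only on the
  carrier.
\<close>

text \<open>The sum in the definition below is finite: \<open>f\<close> is the family of components of \<open>x\<close>.\<close>

definition direct_sum ::
    "('f::field \<Rightarrow> 'a::ab_group_add \<Rightarrow> 'a) \<Rightarrow> 'a set \<Rightarrow> 'i set \<Rightarrow> ('i \<Rightarrow> 'a set) \<Rightarrow> bool" where
  "direct_sum scale V I W \<longleftrightarrow>
     module.subspace scale V \<and>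
     (\<forall>i\<in>I. module.subspace scale (W i) \<and> W i \<subseteq> V) \<and>
     (\<forall>x\<in>V. \<exists>!f. (\<forall>i\<in>I. f i \<in> W i) \<and> (\<forall>i. i \<notin> I \<longrightarrow> f i = 0) \<and>
        finite {i. f i \<noteq> 0} \<and> x = (\<Sum>i | f i \<noteq> 0. f i))"

definition koszul_sign :: "bit \<Rightarrow> bit \<Rightarrow> 'f::field" where
  "koszul_sign i j = (if i = 1 \<and> j = 1 then - 1 else 1)"

locale lie_superalgebra = vector_space scale
  for scale :: "'f::field_char_0 \<Rightarrow> 'a::ab_group_add \<Rightarrow> 'a" +
  fixes br :: "'a \<Rightarrow> 'a \<Rightarrow> 'a"
    and L :: "'a set"
    and par :: "bit \<Rightarrow> 'a set"
  assumes grading: "direct_sum scale L UNIV par"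
    and br_add_left: "\<lbrakk>x \<in> L; y \<in> L; z \<in> L\<rbrakk> \<Longrightarrow> br (x + y) z = br x z + br y z"
    and br_add_right: "\<lbrakk>x \<in> L; y \<in> L; z \<in> L\<rbrakk> \<Longrightarrow> br x (y + z) = br x y + br x z"
    and br_scale_left: "\<lbrakk>x \<in> L; y \<in> L\<rbrakk> \<Longrightarrow> br (scale c x) y = scale c (br x y)"
    and br_scale_right: "\<lbrakk>x \<in> L; y \<in> L\<rbrakk> \<Longrightarrow> br x (scale c y) = scale c (br x y)"
    and br_parity: "\<lbrakk>x \<in> par i; y \<in> par j\<rbrakk> \<Longrightarrow> br x y \<in> par (i + j)"
    and br_skew: "\<lbrakk>x \<in> par i; y \<in> par j\<rbrakk> \<Longrightarrow> br x y = - scale (koszul_sign i j) (br y x)"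
    and br_jacobi: "\<lbrakk>x \<in> par i; y \<in> par j; z \<in> par k\<rbrakk> \<Longrightarrow>
        br x (br y z) = br (br x y) z + scale (koszul_sign i j) (br y (br x z))"

definition subsuperalgebra ::
    "('f::field_char_0 \<Rightarrow> 'a::ab_group_add \<Rightarrow> 'a) \<Rightarrow> ('a \<Rightarrow> 'a \<Rightarrow> 'a) \<Rightarrow> 'a set \<Rightarrow>
     (bit \<Rightarrow> 'a set) \<Rightarrow> 'a set \<Rightarrow> bool" where
  "subsuperalgebra scale br L par K \<longleftrightarrow>
     K \<subseteq> L \<and> direct_sum scale K UNIV (\<lambda>i. K \<inter> par i) \<and> (\<forall>x\<in>K. \<forall>y\<in>K. br x y \<in> K)"

definition generated_subsuperalgebra ::
    "('f::field_char_0 \<Rightarrow> 'a::ab_group_add \<Rightarrow> 'a) \<Rightarrow> ('a \<Rightarrow> 'a \<Rightarrow> 'a) \<Rightarrow> 'a set \<Rightarrow>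
     (bit \<Rightarrow> 'a set) \<Rightarrow> 'a set \<Rightarrow> 'a set" where
  "generated_subsuperalgebra scale br L par S =
     \<Inter>{K. subsuperalgebra scale br L par K \<and> S \<subseteq> K}"

definition sl2_super_triple ::
    "('f::field_char_0 \<Rightarrow> 'a::ab_group_add \<Rightarrow> 'a) \<Rightarrow> ('a \<Rightarrow> 'a \<Rightarrow> 'a) \<Rightarrow> 'a set \<Rightarrow>
     (bit \<Rightarrow> 'a set) \<Rightarrow> 'a \<Rightarrow> 'a \<Rightarrow> 'a \<Rightarrow> bool" where
  "sl2_super_triple scale br G par x y h \<longleftrightarrow>
     lie_superalgebra scale br G par \<and>
     {x, y, h} \<subseteq> G - {0} \<and>
     generated_subsuperalgebra scale br G par {x, y, h} = G \<and>
     (\<exists>i. x \<in> par i \<and> y \<in> par i) \<and>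
     br h x = scale 2 x \<and> br h y = - scale 2 y \<and> br x y = h"

text \<open>
  A functional on \<open>H\<close> is represented by its extension by \<open>0\<close> to the ambient type, which makes
  the representation unique and closed under the pointwise operations.
\<close>

definition dual_space ::
    "('f::field \<Rightarrow> 'a::ab_group_add \<Rightarrow> 'a) \<Rightarrow> 'a set \<Rightarrow> ('a \<Rightarrow> 'f) set" where
  "dual_space scale H =
     {\<alpha>. (\<forall>x\<in>H. \<forall>y\<in>H. \<alpha> (x + y) = \<alpha> x + \<alpha> y) \<and> (\<forall>c. \<forall>x\<in>H. \<alpha> (scale c x) = c * \<alpha> x) \<and>
        (\<forall>x. x \<notin> H \<longrightarrow> \<alpha> x = 0)}"

definition weight_space ::
    "('f::field \<Rightarrow> 'a::ab_group_add \<Rightarrow> 'a) \<Rightarrow> ('a \<Rightarrow> 'a \<Rightarrow> 'a) \<Rightarrow> 'a set \<Rightarrow> 'a set \<Rightarrow>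
     ('a \<Rightarrow> 'f) \<Rightarrow> 'a set" where
  "weight_space scale br L H \<alpha> = {x\<in>L. \<forall>h\<in>H. br h x = scale (\<alpha> h) x}"

locale super_toral_triple = lie_superalgebra scale br L par
  for scale :: "'f::field_char_0 \<Rightarrow> 'a::ab_group_add \<Rightarrow> 'a"
    and br :: "'a \<Rightarrow> 'a \<Rightarrow> 'a"
    and L :: "'a set"
    and par :: "bit \<Rightarrow> 'a set" +
  fixes H :: "'a set"
    and form :: "'a \<Rightarrow> 'a \<Rightarrow> 'f"
  assumes L_nonzero: "L \<noteq> {0}"
    and H_subspace: "module.subspace scale H"
    and H_even: "H \<subseteq> par 0"
    and H_br: "\<lbrakk>h \<in> H; k \<in> H\<rbrakk> \<Longrightarrow> br h k \<in> H"
    and H_nonzero: "H \<noteq> {0}"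
    and form_add_left: "\<lbrakk>x \<in> L; y \<in> L; z \<in> L\<rbrakk> \<Longrightarrow> form (x + y) z = form x z + form y z"
    and form_add_right: "\<lbrakk>x \<in> L; y \<in> L; z \<in> L\<rbrakk> \<Longrightarrow> form x (y + z) = form x y + form x z"
    and form_scale_left: "\<lbrakk>x \<in> L; y \<in> L\<rbrakk> \<Longrightarrow> form (scale c x) y = c * form x y"
    and form_scale_right: "\<lbrakk>x \<in> L; y \<in> L\<rbrakk> \<Longrightarrow> form x (scale c y) = c * form x y"
    and form_even: "\<lbrakk>x \<in> par i; y \<in> par j; i \<noteq> j\<rbrakk> \<Longrightarrow> form x y = 0"
    and form_supersymmetric:
        "\<lbrakk>x \<in> par i; y \<in> par j\<rbrakk> \<Longrightarrow> form x y = koszul_sign i j * form y x"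
    and form_invariant: "\<lbrakk>x \<in> L; y \<in> L; z \<in> L\<rbrakk> \<Longrightarrow> form (br x y) z = form x (br y z)"
    and form_nondegenerate: "\<lbrakk>x \<in> L; \<forall>y\<in>L. form x y = 0\<rbrakk> \<Longrightarrow> x = 0"
    and weight_decomposition: "direct_sum scale L (dual_space scale H) (weight_space scale br L H)"
    and form_nondegenerate_H: "\<lbrakk>h \<in> H; \<forall>k\<in>H. form h k = 0\<rbrakk> \<Longrightarrow> h = 0"

definition root_system ::
    "('f::field \<Rightarrow> 'a::ab_group_add \<Rightarrow> 'a) \<Rightarrow> ('a \<Rightarrow> 'a \<Rightarrow> 'a) \<Rightarrow> 'a set \<Rightarrow> 'a set \<Rightarrow>
     ('a \<Rightarrow> 'f) set" where
  "root_system scale br L H = {\<alpha>\<in>dual_space scale H. weight_space scale br L H \<alpha> \<noteq> {0}}"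

definition weight_space_par ::
    "('f::field \<Rightarrow> 'a::ab_group_add \<Rightarrow> 'a) \<Rightarrow> ('a \<Rightarrow> 'a \<Rightarrow> 'a) \<Rightarrow> 'a set \<Rightarrow> (bit \<Rightarrow> 'a set) \<Rightarrow>
     'a set \<Rightarrow> bit \<Rightarrow> ('a \<Rightarrow> 'f) \<Rightarrow> 'a set" where
  "weight_space_par scale br L par H i \<alpha> = par i \<inter> weight_space scale br L H \<alpha>"

definition root_system_par ::
    "('f::field \<Rightarrow> 'a::ab_group_add \<Rightarrow> 'a) \<Rightarrow> ('a \<Rightarrow> 'a \<Rightarrow> 'a) \<Rightarrow> 'a set \<Rightarrow> (bit \<Rightarrow> 'a set) \<Rightarrow>
     'a set \<Rightarrow> bit \<Rightarrow> ('a \<Rightarrow> 'f) set" where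
  "root_system_par scale br L par H i =
     {\<alpha>\<in>dual_space scale H. weight_space_par scale br L par H i \<alpha> \<noteq> {0}}"

text \<open>
  The element \<open>t\<^sub>\<alpha>\<close>; it is meaningful for those \<open>\<alpha>\<close> that lie in the image of \<open>h \<mapsto> (h, \<cdot>)\<close>, which
  includes every root of an extended affine Lie superalgebra (lemma \<open>root_representable\<close>).
\<close>

definition repr_elt :: "('a \<Rightarrow> 'a \<Rightarrow> 'f) \<Rightarrow> 'a set \<Rightarrow> ('a \<Rightarrow> 'f) \<Rightarrow> 'a" where
  "repr_elt form H \<alpha> = (THE t. t \<in> H \<and> (\<forall>h\<in>H. \<alpha> h = form t h))"

definition dual_form :: "('a \<Rightarrow> 'a \<Rightarrow> 'f) \<Rightarrow> 'a set \<Rightarrow> ('a \<Rightarrow> 'f) \<Rightarrow> ('a \<Rightarrow> 'f) \<Rightarrow> 'f" where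
  "dual_form form H \<alpha> \<beta> = form (repr_elt form H \<alpha>) (repr_elt form H \<beta>)"

locale extended_affine_lie_superalgebra = super_toral_triple scale br L par H form
  for scale :: "'f::field_char_0 \<Rightarrow> 'a::ab_group_add \<Rightarrow> 'a"
    and br :: "'a \<Rightarrow> 'a \<Rightarrow> 'a"
    and L :: "'a set"
    and par :: "bit \<Rightarrow> 'a set"
    and H :: "'a set"
    and form :: "'a \<Rightarrow> 'a \<Rightarrow> 'f" +
  assumes root_vectors: "\<lbrakk>\<alpha> \<in> root_system_par scale br L par H i; \<alpha> \<noteq> (\<lambda>_. 0)\<rbrakk> \<Longrightarrow>
      \<exists>x \<in> weight_space_par scale br L par H i \<alpha>.
      \<exists>y \<in> weight_space_par scale br L par H i (\<lambda>h. - \<alpha> h). br x y \<noteq> 0 \<and> br x y \<in> H"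
    and ad_locally_nilpotent:
      "\<lbrakk>\<alpha> \<in> root_system scale br L H; dual_form form H \<alpha> \<alpha> \<noteq> 0; x \<in> weight_space scale br L H \<alpha>\<rbrakk> \<Longrightarrow>
      \<forall>y\<in>L. \<exists>n. (br x ^^ n) y = 0"


context lie_superalgebra
begin

lemma subspace_L: "subspace L" and subspace_par: "subspace (par i)" and par_subset: "par i \<subseteq> L"
  using grading by (auto simp: direct_sum_def)

lemma sum_bit: "(\<Sum>i | f i \<noteq> 0. f i) = f 0 + f 1" for f :: "bit \<Rightarrow> 'a"
proof -
  have U: "UNIV = {0, 1 :: bit}" using bit_not_zero_iff by blast
  have "(\<Sum>i | f i \<noteq> 0. f i) = (\<Sum>i\<in>UNIV. f i)"
    by (rule sum.mono_neutral_left) (auto simp: U)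
  then show ?thesis by (simp add: U)
qed

lemma grading_decomp:
  assumes "x \<in> L" obtains u v where "u \<in> par 0" "v \<in> par 1" "x = u + v"
proof -
  have "\<exists>f. (\<forall>i. f i \<in> par i) \<and> x = (\<Sum>i | f i \<noteq> 0. f i)"
    using grading assms unfolding direct_sum_def by (metis UNIV_I)
  then show ?thesis using that by (auto simp: sum_bit)
qed

lemma par_Int: assumes "x \<in> par 0" "x \<in> par 1" shows "x = 0"
proof -
  let ?f = "\<lambda>i::bit. if i = 0 then x else 0" and ?g = "\<lambda>i::bit. if i = 0 then 0 else x"
    and ?P = "\<lambda>f. (\<forall>i. f i \<in> par i) \<and> finite {i. f i \<noteq> 0} \<and> x = (\<Sum>i | f i \<noteq> 0. f i)"
  have U: "UNIV = {0, 1 :: bit}" using bit_not_zero_iff by blast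
  have fin: "finite {i. f i \<noteq> 0}" for f :: "bit \<Rightarrow> 'a"
    by (rule finite_subset[OF subset_UNIV]) (metis U finite.emptyI finite.insertI)
  have mem: "?f i \<in> par i" "?g i \<in> par i" for i
    using assms subspace_0[OF subspace_par] bit_not_zero_iff[of i] by auto
  have "x \<in> L" using assms par_subset by auto
  then have ex: "\<exists>!f. ?P f" using grading unfolding direct_sum_def by simp
  have f: "?P ?f" unfolding sum_bit using fin mem by auto
  have g: "?P ?g" unfolding sum_bit using fin mem by auto
  have "f = g" if "\<exists>!x. P x" "P f" "P g" for P and f g :: "bit \<Rightarrow> 'a"
    using that by blast
  from this[of ?P, OF ex f g] have "?f 0 = ?g 0" by (rule fun_cong)
  then show ?thesis by simp
qed

end

context super_toral_triple
begin

lemma root_system_Un: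
  "root_system scale br L H =
     root_system_par scale br L par H 0 \<union> root_system_par scale br L par H 1"
proof (intro equalityI subsetI)
  fix \<alpha> assume a: "\<alpha> \<in> root_system scale br L H"
  have sub: "0 \<in> weight_space_par scale br L par H i \<alpha>" for i
  proof -
    have "br h 0 = 0" if "h \<in> H" for h
      using br_add_right[of h 0 0] that H_even par_subset subspace_0[OF subspace_L] by force
    then show ?thesis
      using subspace_0[OF subspace_L] subspace_0[OF subspace_par]
      by (auto simp: weight_space_par_def weight_space_def)
  qed
  then have "0 \<in> weight_space scale br L H \<alpha>" by (auto simp: weight_space_par_def)
  then obtain x where x: "x \<in> weight_space scale br L H \<alpha>" "x \<noteq> 0"
    using a by (auto simp: root_system_def)
  then obtain u v where uv: "u \<in> par 0" "v \<in> par 1" "x = u + v"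
    using grading_decomp by (auto simp: weight_space_def)
  have uvL: "u \<in> L" "v \<in> L" using uv par_subset by auto
  have comp: "br h u = scale (\<alpha> h) u \<and> br h v = scale (\<alpha> h) v" if h: "h \<in> H" for h
  proof -
    have hL: "h \<in> par 0" "h \<in> L" using h H_even par_subset by auto
    let ?a = "br h u - scale (\<alpha> h) u" and ?b = "scale (\<alpha> h) v - br h v"
    have "br h u + br h v = scale (\<alpha> h) u + scale (\<alpha> h) v"
      using x(1) h br_add_right[of h u v] uvL hL
      by (simp add: weight_space_def uv(3) scale_right_distrib)
    then have eq: "?a = ?b" by (simp add: algebra_simps)
    have "?a \<in> par 0" "?b \<in> par 1"
      using br_parity[of h 0 u 0] br_parity[of h 0 v 1] hL uv subspace_diff subspace_scale
        subspace_par by auto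
    then have "?a = 0" by (intro par_Int) (simp_all only: eq)
    moreover from this have "?b = 0" by (simp only: eq)
    ultimately show ?thesis by simp
  qed
  then have "u \<in> weight_space_par scale br L par H 0 \<alpha>" "v \<in> weight_space_par scale br L par H 1 \<alpha>"
    using uv uvL by (auto simp: weight_space_par_def weight_space_def)
  moreover have "u \<noteq> 0 \<or> v \<noteq> 0" using x uv by auto
  ultimately show "\<alpha> \<in> root_system_par scale br L par H 0 \<union> root_system_par scale br L par H 1"
    using a by (auto simp: root_system_par_def root_system_def)
next
  fix \<alpha>
  assume a: "\<alpha> \<in> root_system_par scale br L par H 0 \<union> root_system_par scale br L par H 1"
  then obtain i where i: "\<alpha> \<in> root_system_par scale br L par H i" by blast
  have "br h 0 = 0" if "h \<in> H" for h
    using br_add_right[of h 0 0] that H_even par_subset subspace_0[OF subspace_L] by force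
  then have "0 \<in> weight_space_par scale br L par H i \<alpha>"
    using subspace_0[OF subspace_L] subspace_0[OF subspace_par]
    by (auto simp: weight_space_par_def weight_space_def)
  then obtain x where "x \<in> weight_space_par scale br L par H i \<alpha>" "x \<noteq> 0"
    using i by (auto simp: root_system_par_def)
  then show "\<alpha> \<in> root_system scale br L H"
    using i by (auto simp: root_system_par_def root_system_def weight_space_par_def)
qed

end

context extended_affine_lie_superalgebra
begin

lemma root_representable:
  assumes "\<alpha> \<in> root_system scale br L H"
  shows "\<exists>!t. t \<in> H \<and> (\<forall>h\<in>H. \<alpha> h = form t h)"
proof -
  have HL: "H \<subseteq> L" using H_even par_subset by blast
  have "\<exists>t\<in>H. \<forall>h\<in>H. \<alpha> h = form t h"
  proof (cases "\<alpha> = (\<lambda>_. 0)")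
    case True
    have "form 0 h = 0" if "h \<in> H" for h
      using form_scale_left[of h h 0] that HL by auto
    with True subspace_0[OF H_subspace] show ?thesis by (intro bexI[of _ 0]) auto
  next
    case False
    obtain i where i: "\<alpha> \<in> root_system_par scale br L par H i"
      using assms root_system_Un by blast
    obtain x y where xy: "x \<in> weight_space_par scale br L par H i \<alpha>"
      "y \<in> weight_space_par scale br L par H i (\<lambda>h. - \<alpha> h)" "br x y \<noteq> 0" "br x y \<in> H"
      using root_vectors[OF i False] by blast
    have L: "x \<in> L" "y \<in> L" and p: "y \<in> par i"
      using xy by (auto simp: weight_space_par_def weight_space_def)
    have key: "form (br x y) h = \<alpha> h * form x y" if h: "h \<in> H" for h
    proof -
      have hp: "h \<in> par 0" "h \<in> L" using h H_even HL by auto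
      have "br y h = - br h y" using br_skew[OF p hp(1)] by (simp add: koszul_sign_def)
      also have "br h y = scale (- \<alpha> h) y"
        using xy(2) h by (auto simp: weight_space_par_def weight_space_def)
      finally have "br y h = scale (\<alpha> h) y" by simp
      then show ?thesis using form_invariant[OF L hp(2)] form_scale_right[OF L] by simp
    qed
    have ne: "form x y \<noteq> 0"
    proof
      assume "form x y = 0"
      then have "\<forall>h\<in>H. form (br x y) h = 0" by (simp add: key)
      then show False using form_nondegenerate_H[OF xy(4)] xy(3) by blast
    qed
    let ?t = "scale (1 / form x y) (br x y)"
    have "?t \<in> H" by (rule subspace_scale[OF H_subspace xy(4)])
    moreover have "\<alpha> h = form ?t h" if "h \<in> H" for h
    proof -
      have "form ?t h = 1 / form x y * form (br x y) h"
        by (rule form_scale_left) (use xy(4) that HL in blast)+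
      then show ?thesis using key[OF that] ne by simp
    qed
    ultimately show ?thesis by blast
  qed
  moreover have "s = t" if s: "s \<in> H" "\<forall>h\<in>H. \<alpha> h = form s h" and t: "t \<in> H" "\<forall>h\<in>H. \<alpha> h = form t h"
    for s t
  proof -
    have d: "s - t \<in> H" by (rule subspace_diff[OF H_subspace s(1) t(1)])
    have "form (s - t) h = 0" if h: "h \<in> H" for h
    proof -
      have "form (s - t + t) h = form (s - t) h + form t h"
        by (rule form_add_left) (use d t(1) h HL in blast)+
      moreover have "form s h = form t h" using s(2) t(2) h by metis
      ultimately show ?thesis by simp
    qed
    then have "s - t = 0" using form_nondegenerate_H[OF d] by blast
    then show ?thesis by simp
  qed
  ultimately show ?thesis by blast
qed

end

end

theory Submission
  imports Defs
begin

text \<open>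
  By invariance, \<open>[x, y] = (x, y) t\<^sub>\<alpha>\<close> for \<open>x \<in> L\<^sup>\<alpha>\<close> and \<open>y \<in> L\<^sup>-\<^sup>\<alpha>\<close> with \<open>[x, y] \<in> H\<close>, so the root vectors
  of the first axiom only have to be rescaled. If they are odd, the Jacobi identity gives
  \<open>[[y\<^sub>\<alpha>, y\<^sub>\<alpha>], y\<^sub>-\<^sub>\<alpha>] = -4 y\<^sub>\<alpha>\<close>, hence \<open>0 \<noteq> [y\<^sub>\<alpha>, y\<^sub>\<alpha>]\<close>, which is even of weight \<open>2\<alpha>\<close>.
\<close>

section \<open>Homogeneous components and graded subspaces\<close>

context lie_superalgebra
begin

text \<open>The axioms place brackets of homogeneous elements only. Expanding both arguments into
  their even and odd components reduces the general case to those.\<close>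

lemma br_in_L: assumes "x \<in> L" "y \<in> L" shows "br x y \<in> L"
proof -
  obtain u v where uv: "u \<in> par 0" "v \<in> par 1" "x = u + v" using grading_decomp assms(1) by blast
  obtain a b where ab: "a \<in> par 0" "b \<in> par 1" "y = a + b" using grading_decomp assms(2) by blast
  have hom: "br p q \<in> L" if "p \<in> par i" "q \<in> par j" for p q i j
    using br_parity[OF that] par_subset by blast
  have mem: "u \<in> L" "v \<in> L" "a \<in> L" "b \<in> L" using uv ab par_subset by blast+
  have "br x y = (br u a + br u b) + (br v a + br v b)"
    using mem assms by (simp add: uv(3) ab(3) br_add_left br_add_right)
  then show ?thesis
    using hom uv(1,2) ab(1,2) by (simp add: subspace_add[OF subspace_L])
qed

lemma br_zero_left: assumes "x \<in> L" shows "br 0 x = 0"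
  using br_add_left[of 0 0 x] assms subspace_0[OF subspace_L] by simp

lemma br_zero_right: assumes "x \<in> L" shows "br x 0 = 0"
  using br_add_right[of x 0 0] assms subspace_0[OF subspace_L] by simp

lemma grading_unique:
  assumes "u \<in> par 0" "v \<in> par 1" "u' \<in> par 0" "v' \<in> par 1" "u + v = u' + v'"
  shows "u = u'" "v = v'"
proof -
  have eq: "u - u' = v' - v" using assms(5) by (simp add: algebra_simps)
  have "u - u' \<in> par 0" "v' - v \<in> par 1"
    using assms subspace_diff[OF subspace_par] by blast+
  then have "u - u' = 0" using eq par_Int by metis
  then show "u = u'" by simp
  then show "v = v'" using assms(5) by simp
qed

text \<open>For a subspace of \<open>L\<close>, only the existence of components inside
  \<open>K\<close> has to be checked: their uniqueness is inherited from the grading of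
  \<open>L\<close>.\<close>

lemma direct_sum_gradedI:
  assumes K: "K \<subseteq> L" "subspace K"
    and dec: "\<And>x. x \<in> K \<Longrightarrow> \<exists>u \<in> K \<inter> par 0. \<exists>v \<in> K \<inter> par 1. x = u + v"
  shows "direct_sum scale K UNIV (\<lambda>i. K \<inter> par i)"
proof -
  have fin: "finite {i. f i \<noteq> 0}" for f :: "bit \<Rightarrow> 'a"
  proof (rule finite_subset[of _ "{0, 1}"])
    show "{i. f i \<noteq> 0} \<subseteq> {0, 1}" using bit_not_zero_iff by blast
  qed simp
  have "\<exists>!f. (\<forall>i\<in>UNIV. f i \<in> K \<inter> par i) \<and> (\<forall>i. i \<notin> UNIV \<longrightarrow> f i = 0) \<and>
        finite {i. f i \<noteq> 0} \<and> x = (\<Sum>i | f i \<noteq> 0. f i)" if x: "x \<in> K" for x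
  proof -
    obtain u v where uv: "u \<in> K \<inter> par 0" "v \<in> K \<inter> par 1" "x = u + v" using dec[OF x] by blast
    show ?thesis
    proof (rule ex1I[of _ "\<lambda>i::bit. if i = 0 then u else v"], goal_cases)
      case 1
      have "(if i = 0 then u else v) \<in> K \<inter> par i" for i :: bit
        using uv bit_not_zero_iff[of i] by auto
      then show ?case using uv fin unfolding sum_bit by auto
    next
      case (2 f)
      then have f: "f 0 \<in> par 0" "f 1 \<in> par 1" "u + v = f 0 + f 1"
        using uv(3) unfolding sum_bit by auto
      have "u = f 0" "v = f 1" using grading_unique[OF _ _ f] uv by auto
      then show ?case using bit_not_zero_iff by fastforce
    qed
  qed
  then show ?thesis
    unfolding direct_sum_def using K subspace_inter[OF K(2) subspace_par] by auto
qed

lemma subsuperalgebra_decomp: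
  assumes "subsuperalgebra scale br L par K" "x \<in> K"
  shows "\<exists>u \<in> K \<inter> par 0. \<exists>v \<in> K \<inter> par 1. x = u + v"
proof -
  have "\<exists>f. (\<forall>i. f i \<in> K \<inter> par i) \<and> x = (\<Sum>i | f i \<noteq> 0. f i)"
    using assms unfolding subsuperalgebra_def direct_sum_def by (metis UNIV_I)
  then show ?thesis unfolding sum_bit by blast
qed

section \<open>Generated subsuperalgebras\<close>

lemma subsuperalgebra_whole: "subsuperalgebra scale br L par L"
proof -
  have "(\<lambda>i. L \<inter> par i) = par" using par_subset by auto
  then show ?thesis unfolding subsuperalgebra_def using grading br_in_L by simp
qed

lemma subset_generated: "S \<subseteq> generated_subsuperalgebra scale br L par S"
  unfolding generated_subsuperalgebra_def by blast

text \<open>Closure under linear operations and brackets passes to intersections. So does the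
  grading: the components that \<open>x\<close> has inside each \<open>K\<close> are its components
  in \<open>L\<close>, hence are the same for all \<open>K\<close>.\<close>

lemma subsuperalgebra_generated:
  assumes "S \<subseteq> L"
  shows "subsuperalgebra scale br L par (generated_subsuperalgebra scale br L par S)"
proof -
  let ?F = "{K. subsuperalgebra scale br L par K \<and> S \<subseteq> K}"
  let ?G = "generated_subsuperalgebra scale br L par S"
  have G: "?G = \<Inter>?F" by (simp add: generated_subsuperalgebra_def)
  \<comment> \<open>The family that is intersected contains \<open>L\<close> itself, so it is
    nonempty.\<close>
  have GL: "?G \<subseteq> L" unfolding G using subsuperalgebra_whole assms by blast
  have sub: "subspace ?G"
    unfolding G by (rule subspace_Inter) (auto simp: subsuperalgebra_def direct_sum_def)
  have "\<exists>u \<in> ?G \<inter> par 0. \<exists>v \<in> ?G \<inter> par 1. x = u + v" if x: "x \<in> ?G" for x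
  proof -
    obtain u v where uv: "u \<in> par 0" "v \<in> par 1" "x = u + v" using grading_decomp x GL by blast
    have "u \<in> K \<and> v \<in> K" if K: "K \<in> ?F" for K
    proof -
      have "x \<in> K" using x K unfolding G by blast
      then obtain u' v' where "u' \<in> K \<inter> par 0" "v' \<in> K \<inter> par 1" "x = u' + v'"
        using subsuperalgebra_decomp K by blast
      then show ?thesis using grading_unique[OF uv(1,2), of u' v'] uv(3) by auto
    qed
    then show ?thesis using uv unfolding G by blast
  qed
  moreover have "br x y \<in> ?G" if "x \<in> ?G" "y \<in> ?G" for x y
    using that unfolding G subsuperalgebra_def by blast
  ultimately show ?thesis
    unfolding subsuperalgebra_def using GL direct_sum_gradedI[OF GL sub] by blast
qed

lemma lie_superalgebra_subsuperalgebra: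
  assumes "subsuperalgebra scale br L par K"
  shows "lie_superalgebra scale br K (\<lambda>i. K \<inter> par i)"
proof -
  have K: "K \<subseteq> L" "direct_sum scale K UNIV (\<lambda>i. K \<inter> par i)"
    "\<And>x y. \<lbrakk>x \<in> K; y \<in> K\<rbrakk> \<Longrightarrow> br x y \<in> K"
    using assms by (auto simp: subsuperalgebra_def)
  show ?thesis
  proof (unfold_locales, goal_cases)
    case 1 then show ?case by (rule K)
  next
    case (2 x y z) then show ?case using br_add_left K(1) by blast
  next
    case (3 x y z) then show ?case using br_add_right K(1) by blast
  next
    case (4 x y c) then show ?case using br_scale_left K(1) by blast
  next
    case (5 x y c) then show ?case using br_scale_right K(1) by blast
  next
    case (6 x i y j) then show ?case using br_parity K(3) by blast
  next
    case (7 x i y j) then show ?case using br_skew by blast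
  next
    case (8 x i y j z k) then show ?case using br_jacobi by blast
  qed
qed

text \<open>Needed because \<open>sl2_super_triple\<close> speaks of generation inside
  \<open>G\<close>, whereas \<open>G\<close> is generated inside \<open>L\<close>. The
  subsuperalgebras of \<open>G\<close> are exactly those of \<open>L\<close> that lie in
  \<open>G\<close>, and \<open>G\<close> is the least one containing \<open>S\<close> in either
  sense.\<close>

lemma generated_in_generated:
  assumes "S \<subseteq> L" and G: "G = generated_subsuperalgebra scale br L par S"
  shows "generated_subsuperalgebra scale br G (\<lambda>i. G \<inter> par i) S = G"
proof -
  have subG: "subsuperalgebra scale br L par G"
    unfolding G by (rule subsuperalgebra_generated[OF assms(1)])
  then have GL: "G \<subseteq> L" by (simp add: subsuperalgebra_def)
  have iff: "subsuperalgebra scale br G (\<lambda>i. G \<inter> par i) K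
      \<longleftrightarrow> K \<subseteq> G \<and> subsuperalgebra scale br L par K" for K
  proof (cases "K \<subseteq> G")
    case True
    then have "(\<lambda>i. K \<inter> (G \<inter> par i)) = (\<lambda>i. K \<inter> par i)" by auto
    then show ?thesis using True GL by (auto simp: subsuperalgebra_def)
  qed (simp add: subsuperalgebra_def)
  have "S \<subseteq> G" unfolding G by (rule subset_generated)
  moreover have "G \<subseteq> K" if "subsuperalgebra scale br L par K" "S \<subseteq> K" for K
    unfolding G generated_subsuperalgebra_def using that by blast
  ultimately show ?thesis
    unfolding generated_subsuperalgebra_def iff using subG by blast
qed

section \<open>The sl2 relations and odd squares\<close>

lemma sl2_super_triple_generated:
  assumes "x \<in> par i" "y \<in> par i" "br x y = h" "br h x = scale 2 x" "br h y = - scale 2 y" "h \<noteq> 0"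
    and G: "G = generated_subsuperalgebra scale br L par {x, y, h}"
  shows "sl2_super_triple scale br G (\<lambda>j. G \<inter> par j) x y h"
proof -
  have mem: "x \<in> L" "y \<in> L" using assms(1,2) par_subset by blast+
  then have S: "{x, y, h} \<subseteq> L" using br_in_L assms(3) by blast
  have "x \<noteq> 0" "y \<noteq> 0"
    using assms(3,6) br_zero_left[OF mem(2)] br_zero_right[OF mem(1)] by auto
  moreover have "{x, y, h} \<subseteq> G" unfolding G by (rule subset_generated)
  moreover have "lie_superalgebra scale br G (\<lambda>j. G \<inter> par j)"
    unfolding G by (rule lie_superalgebra_subsuperalgebra[OF subsuperalgebra_generated[OF S]])
  ultimately show ?thesis
    unfolding sl2_super_triple_def using assms generated_in_generated[OF S G] by blast
qed

text \<open>If \<open>[x, x] = 0\<close>, the Jacobi identity forces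
  \<open>2 [x, [x, y]] = 0\<close>. But \<open>[x, y]\<close> is even, so
  \<open>[x, [x, y]] = -[[x, y], x] = -2 x\<close>, and \<open>4 x = 0\<close> is impossible in
  characteristic zero.\<close>

lemma odd_square_nonzero:
  assumes "x \<in> par 1" "y \<in> par 1" "br (br x y) x = scale 2 x" "x \<noteq> 0"
  shows "br x x \<noteq> 0"
proof
  assume xx: "br x x = 0"
  have mem: "x \<in> L" "y \<in> L" using assms(1,2) par_subset by blast+
  have h: "br x y \<in> par 0" using br_parity[OF assms(1,2)] by simp
  \<comment> \<open>Interchanging the two odd copies of \<open>x\<close> in the Jacobi identity
    produces the minus sign.\<close>
  have neg: "br x (br x y) = - br x (br x y)"
    using br_jacobi[OF assms(1,1,2)] xx br_zero_left[OF mem(2)] by (simp add: koszul_sign_def)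
  have "br x (br x y) = - scale 2 x"
    using br_skew[OF assms(1) h] assms(3) by (simp add: koszul_sign_def)
  then have "scale 2 x + scale 2 x = 0" using neg by (metis add.right_inverse minus_minus)
  then have "scale 4 x = 0" by (simp flip: scale_left_distrib)
  then show False using assms(4) by simp
qed

end

section \<open>Weights and the invariant form\<close>

context super_toral_triple
begin

lemma H_subset: "H \<subseteq> L"
  using H_even par_subset by blast

text \<open>An even \<open>h\<close> acts as a derivation, so weights add. The square is even for
  either parity, since \<open>i + i = 0\<close> in \<open>bit\<close>.\<close>

lemma weight_space_par_square:
  assumes "x \<in> weight_space_par scale br L par H i \<alpha>"
  shows "br x x \<in> weight_space_par scale br L par H 0 (\<lambda>h. 2 * \<alpha> h)"
proof -
  have x: "x \<in> par i" "x \<in> L" "\<And>h. h \<in> H \<Longrightarrow> br h x = scale (\<alpha> h) x"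
    using assms by (auto simp: weight_space_par_def weight_space_def)
  have "br h (br x x) = scale (2 * \<alpha> h) (br x x)" if h: "h \<in> H" for h
  proof -
    have "br h (br x x) = br (br h x) x + br x (br h x)"
      using br_jacobi[of h 0 x i x i] h H_even x(1) by (auto simp: koszul_sign_def)
    then show ?thesis
      using x h by (simp add: br_scale_left br_scale_right flip: scale_left_distrib)
  qed
  then show ?thesis
    using br_parity[OF x(1) x(1)] br_in_L[OF x(2) x(2)]
    by (auto simp: weight_space_par_def weight_space_def)
qed

text \<open>Both sides lie in \<open>H\<close>, where the form is nondegenerate, so it suffices to
  pair them with \<open>h \<in> H\<close>. Invariance gives \<open>([x, y], h) = (x, [y, h]) =
  \<alpha>(h) (x, y) = (x, y) (t, h)\<close>.\<close>

lemma br_opposite_weights: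
  assumes x: "x \<in> L" and y: "y \<in> weight_space_par scale br L par H i (\<lambda>h. - \<alpha> h)"
    and xy: "br x y \<in> H" and t: "t \<in> H" "\<And>h. h \<in> H \<Longrightarrow> \<alpha> h = form t h"
  shows "br x y = scale (form x y) t"
proof -
  have yL: "y \<in> L" "y \<in> par i" and wt: "\<And>h. h \<in> H \<Longrightarrow> br h y = scale (- \<alpha> h) y"
    using y by (auto simp: weight_space_par_def weight_space_def)
  let ?s = "scale (form x y) t"
  have s: "?s \<in> H" by (rule subspace_scale[OF H_subspace t(1)])
  have d: "br x y - ?s \<in> H" by (rule subspace_diff[OF H_subspace xy s])
  have "form (br x y - ?s) h = 0" if h: "h \<in> H" for h
  proof -
    have hL: "h \<in> L" "h \<in> par 0" using h H_subset H_even by auto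
    have "br y h = scale (\<alpha> h) y"
      using br_skew[OF yL(2) hL(2)] wt[OF h] by (simp add: koszul_sign_def)
    then have "form (br x y) h = form t h * form x y"
      using form_invariant[OF x yL(1) hL(1)] form_scale_right[OF x yL(1)] t(2)[OF h] by simp
    moreover have "form ?s h = form x y * form t h"
      using form_scale_left t(1) hL(1) H_subset by blast
    moreover have "form (br x y) h = form (br x y - ?s) h + form ?s h"
      using form_add_left[of "br x y - ?s" ?s h] d s hL(1) H_subset by auto
    ultimately show ?thesis by simp
  qed
  then show ?thesis using form_nondegenerate_H[OF d] by simp
qed

end

section \<open>Triples attached to roots of nonzero length\<close>

context extended_affine_lie_superalgebra
begin

lemma repr_elt_root:
  assumes "\<alpha> \<in> root_system scale br L H"
  shows "repr_elt form H \<alpha> \<in> H" "\<And>h. h \<in> H \<Longrightarrow> \<alpha> h = form (repr_elt form H \<alpha>) h"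
  using theI'[OF root_representable[OF assms]] unfolding repr_elt_def by blast+

text \<open>These relations serve both the construction of the triple and the proof that the double
  of an odd root is an even root.\<close>

lemma root_sl2_relations:
  assumes \<alpha>: "\<alpha> \<in> root_system_par scale br L par H i" and nz: "dual_form form H \<alpha> \<alpha> \<noteq> 0"
    and h: "h = scale (2 / dual_form form H \<alpha> \<alpha>) (repr_elt form H \<alpha>)"
  obtains y z where "y \<in> weight_space_par scale br L par H i \<alpha>"
    "z \<in> weight_space_par scale br L par H i (\<lambda>h. - \<alpha> h)"
    "br y z = h" "br h y = scale 2 y" "br h z = - scale 2 z" "h \<noteq> 0"
proof -
  let ?t = "repr_elt form H \<alpha>" and ?q = "dual_form form H \<alpha> \<alpha>"
  have R: "\<alpha> \<in> root_system scale br L H"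
    using \<alpha> root_system_Un bit_not_zero_iff[of i] by (cases "i = 0") auto
  note t = repr_elt_root[OF R]
  \<comment> \<open>Since \<open>\<alpha>(t) = (t, t) = (\<alpha>, \<alpha>)\<close> is nonzero,
    \<open>\<alpha>\<close> is a nonzero root and \<open>root_vectors\<close> applies.\<close>
  have \<alpha>t: "\<alpha> ?t = ?q" using t(2)[OF t(1)] by (simp add: dual_form_def)
  then have "\<alpha> \<noteq> (\<lambda>_. 0)" using nz by auto
  then obtain x y where x: "x \<in> weight_space_par scale br L par H i \<alpha>"
    and y: "y \<in> weight_space_par scale br L par H i (\<lambda>h. - \<alpha> h)"
    and xy: "br x y \<noteq> 0" "br x y \<in> H"
    using root_vectors[OF \<alpha>] by blast
  have xL: "x \<in> L" and yL: "y \<in> L" and yp: "y \<in> par i"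
    using x y by (auto simp: weight_space_par_def weight_space_def)
  have xyt: "br x y = scale (form x y) ?t" by (rule br_opposite_weights[OF xL y xy(2) t])
  then have f: "form x y \<noteq> 0" "?t \<noteq> 0" using xy(1) by auto
  \<comment> \<open>Rescaling \<open>y\<close> suffices: as \<open>[x, y] = (x, y) t\<close>, this
    factor turns the bracket into \<open>2 t / (\<alpha>, \<alpha>) = h\<close>.\<close>
  let ?z = "scale (2 / (?q * form x y)) y"
  have hH: "h \<in> H" unfolding h by (rule subspace_scale[OF H_subspace t(1)])
  have "\<alpha> h = 2"
    using R t(1) \<alpha>t nz by (simp add: h root_system_def dual_space_def)
  have z: "?z \<in> weight_space_par scale br L par H i (\<lambda>h. - \<alpha> h)"
  proof -
    have "br k ?z = scale (- \<alpha> k) ?z" if "k \<in> H" for k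
    proof -
      have "br k y = scale (- \<alpha> k) y"
        using y that by (auto simp: weight_space_par_def weight_space_def)
      then show ?thesis
        using br_scale_right[of k y] that H_subset yL by (auto simp: mult.commute)
    qed
    then show ?thesis
      using subspace_scale[OF subspace_L yL] subspace_scale[OF subspace_par yp]
      by (simp add: weight_space_par_def weight_space_def)
  qed
  show thesis
  proof (rule that[OF x z])
    show "br x ?z = h" using f(1) by (simp add: br_scale_right[OF xL yL] xyt h)
    show "br h x = scale 2 x"
      using x hH \<open>\<alpha> h = 2\<close> by (auto simp: weight_space_par_def weight_space_def)
    have "br h ?z = scale (- \<alpha> h) ?z"
      using z hH by (simp only: weight_space_par_def weight_space_def) blast
    then show "br h ?z = - scale 2 ?z" by (simp add: \<open>\<alpha> h = 2\<close>)
    show "h \<noteq> 0" using nz f(2) by (simp add: h)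
  qed
qed

lemma root_sl2_super_triple:
  assumes "\<alpha> \<in> root_system_par scale br L par H i" "dual_form form H \<alpha> \<alpha> \<noteq> 0"
    and "h = scale (2 / dual_form form H \<alpha> \<alpha>) (repr_elt form H \<alpha>)"
  shows "\<exists>y \<in> weight_space_par scale br L par H i \<alpha>.
    \<exists>z \<in> weight_space_par scale br L par H i (\<lambda>h. - \<alpha> h).
      let G = generated_subsuperalgebra scale br L par {y, z, h} in
      sl2_super_triple scale br G (\<lambda>j. G \<inter> par j) y z h"
proof -
  obtain y z where yz: "y \<in> weight_space_par scale br L par H i \<alpha>"
    "z \<in> weight_space_par scale br L par H i (\<lambda>h. - \<alpha> h)"
    "br y z = h" "br h y = scale 2 y" "br h z = - scale 2 z" "h \<noteq> 0"
    using root_sl2_relations[OF assms] .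
  have "y \<in> par i" "z \<in> par i" using yz(1,2) by (auto simp: weight_space_par_def)
  from sl2_super_triple_generated[OF this yz(3-6) refl] show ?thesis
    unfolding Let_def using yz(1,2) by blast
qed

lemma double_odd_root:
  assumes \<alpha>: "\<alpha> \<in> root_system_par scale br L par H 1" and nz: "dual_form form H \<alpha> \<alpha> \<noteq> 0"
  shows "(\<lambda>h. 2 * \<alpha> h) \<in> root_system_par scale br L par H 0"
proof -
  obtain h y z where yz: "y \<in> weight_space_par scale br L par H 1 \<alpha>"
    "z \<in> weight_space_par scale br L par H 1 (\<lambda>h. - \<alpha> h)"
    "br y z = h" "br h y = scale 2 y" "h \<noteq> 0"
    using root_sl2_relations[OF \<alpha> nz refl] by metis
  have p: "y \<in> par 1" "z \<in> par 1" using yz(1,2) by (auto simp: weight_space_par_def)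
  have "y \<noteq> 0" using yz(3,5) br_zero_left[of z] p(2) par_subset by auto
  \<comment> \<open>The hypothesis on \<open>[[y, z], y]\<close> is the relation
    \<open>[h, y] = 2 y\<close>.\<close>
  then have "br y y \<noteq> 0" using odd_square_nonzero[OF p] yz(3,4) by simp
  \<comment> \<open>Doubling keeps the value 0 outside \<open>H\<close>, so the function still
    represents a functional on \<open>H\<close>.\<close>
  moreover have "(\<lambda>h. 2 * \<alpha> h) \<in> dual_space scale H"
    using \<alpha> by (auto simp: root_system_par_def dual_space_def algebra_simps)
  ultimately show ?thesis
    using weight_space_par_square[OF yz(1)] by (auto simp: root_system_par_def)
qed

end

theorem lemma3p6:
  fixes scale :: "'f::field_char_0 \<Rightarrow> 'a::ab_group_add \<Rightarrow> 'a"
    and br :: "'a \<Rightarrow> 'a \<Rightarrow> 'a"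
    and L H :: "'a set"
    and par :: "bit \<Rightarrow> 'a set"
    and form :: "'a \<Rightarrow> 'a \<Rightarrow> 'f"
  assumes "extended_affine_lie_superalgebra scale br L par H form"
  shows "(\<forall>i. \<forall>\<alpha> \<in> root_system_par scale br L par H i. dual_form form H \<alpha> \<alpha> \<noteq> 0 \<longrightarrow>
            (let h = scale (2 / dual_form form H \<alpha> \<alpha>) (repr_elt form H \<alpha>) in
             \<exists>y \<in> weight_space_par scale br L par H i \<alpha>.
             \<exists>z \<in> weight_space_par scale br L par H i (\<lambda>h. - \<alpha> h).
               let G = generated_subsuperalgebra scale br L par {y, z, h} in
               sl2_super_triple scale br G (\<lambda>j. G \<inter> par j) y z h))
       \<and> (\<forall>\<alpha> \<in> root_system_par scale br L par H 1. dual_form form H \<alpha> \<alpha> \<noteq> 0 \<longrightarrow>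
            (\<lambda>h. 2 * \<alpha> h) \<in> root_system_par scale br L par H 0)"
proof -
  interpret extended_affine_lie_superalgebra scale br L par H form by (rule assms)
  show ?thesis
    unfolding Let_def
    by (intro conjI allI ballI impI double_odd_root root_sl2_super_triple[OF _ _ refl, unfolded Let_def])
qed

end
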